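(* Let $G$ be a finite connected bipartite simple graph with (non-empty) partite sets $X$ and $Y$, let $K$ be a field, let $S$ be the polynomial ring over $K$ whose variables are the vertices of $G$, and let $I=I(G)\subset S$ be the edge ideal of $G$. Then $\mathrm v(I^k)=2k-1$ for all $$k\geq \min\bigl\{|Y|+1-\max\{\deg (x)\mid x\in X\},\ |X|+1-\max\{\deg (y)\mid y\in Y\}\bigr\}.$$
   Context: $S=\bigoplus_{d\ge 0}S_d$ is standard graded (each variable has degree 1). $G$ is bipartite with partite sets $X,Y$ if $V(G)=X\sqcup Y$ with $X,Y$ non-empty and every edge has one endpoint in $X$ and the other in $Y$. For a vertex $x$, $\deg(x)$ is the number of vertices adjacent to $x$. The edge ideal is $I(G)=\langle xy\mid \{x,y\}\in E(G)\rangle$. For a proper graded ideal $I\subset S$, $\mathrm{v}(I):=\min\{d\geq 0\mid \exists f\in S_d,\ \mathfrak{p}\in\operatorname{Ass}(I)\text{ with }(I:f)=\mathfrak{p}\}$, where $\operatorname{Ass}(I)$ is the set of associated primes of $S/I$ and $(I:f)=\{g\in S\mid gf\in I\}$. *)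

theory Defs
  imports
    "HOL-Algebra.QuotRing"
    "HOL-Algebra.Ideal_Product"
    "HOL-Library.Poly_Mapping"
    "Graph_Theory.Digraph_Component"
begin

text \<open>Finitely supported maps from exponent vectors to coefficients; \<open>(*)\<close> is convolution. Variables
  range over the type \<open>'a\<close>, and the ring below keeps only the polynomials in the variables \<open>V\<close>.\<close>

type_synonym ('a, 'k) mpoly = "('a \<Rightarrow>\<^sub>0 nat) \<Rightarrow>\<^sub>0 'k"

definition pvar :: "'a \<Rightarrow> ('a, 'k::field) mpoly" where
  "pvar x = Poly_Mapping.single (Poly_Mapping.single x 1) 1"

definition poly_ring :: "'a set \<Rightarrow> ('a, 'k::field) mpoly ring" where
  "poly_ring V =
     \<lparr> carrier = {p. \<forall>m \<in> Poly_Mapping.keys p. Poly_Mapping.keys m \<subseteq> V},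
       monoid.mult = (*), one = 1, ring.zero = 0, ring.add = (+) \<rparr>"

lemma cring_poly_ring: "cring (poly_ring V :: ('a, 'k::field) mpoly ring)"
proof (rule cringI)
  show "abelian_group (poly_ring V :: ('a, 'k::field) mpoly ring)"
  proof (rule abelian_groupI)
    fix x :: "('a, 'k) mpoly"
    assume "x \<in> carrier (poly_ring V)"
    then have "- x \<in> carrier (poly_ring V)"
      by (auto simp: poly_ring_def)
    then show "\<exists>y\<in>carrier (poly_ring V). y \<oplus>\<^bsub>poly_ring V\<^esub> x = \<zero>\<^bsub>poly_ring V\<^esub>"
      by (intro bexI[of _ "- x"]) (simp_all add: poly_ring_def)
  qed (auto simp: poly_ring_def ac_simps dest!: subsetD[OF Poly_Mapping.keys_add])
  show "Group.comm_monoid (poly_ring V :: ('a, 'k::field) mpoly ring)"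
  proof (rule comm_monoidI)
    fix x y :: "('a, 'k) mpoly"
    assume "x \<in> carrier (poly_ring V)" "y \<in> carrier (poly_ring V)"
    then show "x \<otimes>\<^bsub>poly_ring V\<^esub> y \<in> carrier (poly_ring V)"
      by (auto simp: poly_ring_def dest!: subsetD[OF Poly_Mapping.keys_mult]
          subsetD[OF Poly_Mapping.keys_add])
  qed (auto simp: poly_ring_def ac_simps)
qed (auto simp: poly_ring_def distrib_right)

definition graded_piece :: "'a set \<Rightarrow> nat \<Rightarrow> ('a, 'k::field) mpoly set" where
  "graded_piece V d =
     {f \<in> carrier (poly_ring V). \<forall>m \<in> Poly_Mapping.keys f.
        (\<Sum>x \<in> Poly_Mapping.keys m. Poly_Mapping.lookup m x) = d}"

definition colon_ideal :: "('r, 'm) ring_scheme \<Rightarrow> 'r set \<Rightarrow> 'r \<Rightarrow> 'r set" where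
  "colon_ideal R I f = {g \<in> carrier R. g \<otimes>\<^bsub>R\<^esub> f \<in> I}"

text \<open>The associated primes of the module \<open>R/I\<close>: prime ideals of \<open>R\<close> that are the
  annihilator of some element of \<open>R/I\<close>, where \<open>g \<in> R\<close> acts as multiplication by its class.\<close>

definition assoc_primes :: "('r, 'm) ring_scheme \<Rightarrow> 'r set \<Rightarrow> 'r set set" where
  "assoc_primes R I =
     {P. primeideal P R \<and>
         (\<exists>x \<in> carrier (R Quot I).
            P = {g \<in> carrier R. (I +>\<^bsub>R\<^esub> g) \<otimes>\<^bsub>R Quot I\<^esub> x = \<zero>\<^bsub>R Quot I\<^esub>})}"

text \<open>For a proper graded ideal the set below is nonempty, so the infimum is its minimum.
  (The infimum of the empty set of natural numbers would be \<open>0\<close>.)\<close>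

definition v_number :: "'a set \<Rightarrow> ('a, 'k::field) mpoly set \<Rightarrow> nat" where
  "v_number V I =
     Inf {d. \<exists>f \<in> graded_piece V d. \<exists>P \<in> assoc_primes (poly_ring V) I.
               colon_ideal (poly_ring V) I f = P}"

text \<open>A finite simple graph is a symmetric loop-free digraph without multiple arcs (locale
  \<open>graph\<close>): an edge \<open>{u, v}\<close> is a pair of opposite arcs, and \<open>u \<rightarrow>\<^bsub>G\<^esub> v\<close> is adjacency.\<close>

definition vdeg :: "('a, 'b) pre_digraph \<Rightarrow> 'a \<Rightarrow> nat" where
  "vdeg G x = card {y \<in> verts G. x \<rightarrow>\<^bsub>G\<^esub> y}"

definition partite_sets :: "('a, 'b) pre_digraph \<Rightarrow> 'a set \<Rightarrow> 'a set \<Rightarrow> bool" where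
  "partite_sets G X Y \<longleftrightarrow>
     verts G = X \<union> Y \<and> X \<inter> Y = {} \<and> X \<noteq> {} \<and> Y \<noteq> {} \<and>
     (\<forall>u v. u \<rightarrow>\<^bsub>G\<^esub> v \<longrightarrow> u \<in> X \<and> v \<in> Y \<or> u \<in> Y \<and> v \<in> X)"

definition edge_ideal :: "('a, 'b) pre_digraph \<Rightarrow> ('a, 'k::field) mpoly set" where
  "edge_ideal G = Idl\<^bsub>poly_ring (verts G)\<^esub> {pvar u * pvar v | u v. u \<rightarrow>\<^bsub>G\<^esub> v}"

text \<open>Powers taken in the multiplicative monoid of ideals, so \<open>I\<^sup>0\<close> is the whole ring.\<close>

definition ideal_power :: "('r, 'm) ring_scheme \<Rightarrow> 'r set \<Rightarrow> nat \<Rightarrow> 'r set" where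
  "ideal_power R I k = I [^]\<^bsub>ideals_set R\<^esub> k"

end

theory Submission
  imports Defs
begin

text \<open>
  Write \<open>I = I(G)\<close>. Every edge meets both \<open>X\<close> and \<open>Y\<close>, so every monomial of a polynomial in \<open>I\<^sup>k\<close>
  has degree at least \<open>k\<close> in the variables \<open>X\<close> and at least \<open>k\<close> in the variables \<open>Y\<close>. This
  bigraded estimate controls both inequalities.

  Lower bound (\<open>v_number_lower_bound\<close>). If \<open>(I\<^sup>k : f)\<close> is a prime \<open>P\<close>, then \<open>I\<^sup>k \<subseteq> P\<close>, hence
  \<open>I \<subseteq> P\<close>, and \<open>P\<close> contains an endpoint \<open>z\<close> of some edge. Now \<open>f \<noteq> 0\<close> and \<open>z f \<in> I\<^sup>k\<close> lives in
  degrees at least \<open>2k\<close>, so \<open>deg f \<ge> 2k - 1\<close>.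

  Upper bound (\<open>v_number_edge_power\<close>). By the symmetry between \<open>X\<close> and \<open>Y\<close> let
  \<open>k \<ge> |Y| + 1 - deg x\<^sub>0\<close> with \<open>x\<^sub>0 \<in> X\<close>. Suppose that a monomial \<open>f\<close> of degree \<open>k\<close> in \<open>X\<close> and
  \<open>k - 1\<close> in \<open>Y\<close> satisfies \<open>y f \<in> I\<^sup>k\<close> for all \<open>y \<in> Y\<close>. Then \<open>(I\<^sup>k : f)\<close> is the prime ideal
  generated by the variables \<open>Y\<close>: it contains them, and a monomial free of \<open>Y\<close> cannot raise the
  \<open>Y\<close>-degree of \<open>f\<close> to \<open>k\<close> (\<open>colon_monomial\<close>).

  Such an \<open>f\<close> is grown edge by edge (\<open>monomial_for_many_neighbours\<close>). For \<open>k = 1\<close> the monomial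
  \<open>f = x\<^sub>0\<close> satisfies \<open>y f \<in> I\<close> for all \<open>y\<close> in \<open>T = N(x\<^sub>0)\<close>, a set of \<open>deg x\<^sub>0\<close> elements. If
  \<open>y f \<in> I\<^sup>k\<close> for all \<open>y \<in> T\<close> and \<open>T \<noteq> Y\<close>, connectedness provides \<open>t \<in> T\<close> and
  \<open>y' \<in> Y - T\<close> with a common neighbour \<open>x\<close>. Replacing \<open>f\<close> by \<open>f x t\<close> keeps all of \<open>T\<close>, with
  \<open>k + 1\<close> in place of \<open>k\<close>, and adds \<open>y'\<close>, because \<open>y' (f x t) = (t f) (x y')\<close>. So one new
  element of \<open>Y\<close> is gained for each increment of \<open>k\<close>, and \<open>T = Y\<close> is reached when
  \<open>k = |Y| + 1 - deg x\<^sub>0\<close>. After that, multiplying by any edge preserves the property.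
\<close>

section \<open>Polynomials and monomials\<close>

lemma poly_ring_simps [simp]:
  "carrier (poly_ring V :: ('a, 'k::field) mpoly ring) =
     {p. \<forall>m \<in> Poly_Mapping.keys p. Poly_Mapping.keys m \<subseteq> V}"
  "x \<otimes>\<^bsub>poly_ring V\<^esub> y = x * y"
  "x \<oplus>\<^bsub>poly_ring V\<^esub> y = x + y"
  "\<one>\<^bsub>poly_ring V\<^esub> = 1"
  "\<zero>\<^bsub>poly_ring V\<^esub> = 0"
  by (simp_all add: poly_ring_def)

lemma ring_poly_ring: "ring (poly_ring V :: ('a, 'k::field) mpoly ring)"
  by (rule cring.axioms(1)[OF cring_poly_ring])

abbreviation monomial :: "('a \<Rightarrow>\<^sub>0 nat) \<Rightarrow> ('a, 'k::field) mpoly" where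
  "monomial m \<equiv> Poly_Mapping.single m 1"

text \<open>Only one pair of monomials of \<open>f\<close> and \<open>g\<close> contributes to this coefficient of the product,
  so nothing can cancel. Cancellation in the monoid of exponents makes uniqueness of the first
  summand sufficient.\<close>

lemma lookup_mult_unique_decomposition:
  fixes f g :: "('a, 'k::field) mpoly"
  assumes "\<And>a' b'. \<lbrakk>a' \<in> Poly_Mapping.keys f; b' \<in> Poly_Mapping.keys g; a' + b' = a + b\<rbrakk>
             \<Longrightarrow> a' = a"
  shows "Poly_Mapping.lookup (f * g) (a + b) = Poly_Mapping.lookup f a * Poly_Mapping.lookup g b"
proof -
  have "Poly_Mapping.lookup f l * (\<Sum>q. Poly_Mapping.lookup g q when a + b = l + q)
      = (Poly_Mapping.lookup f l * Poly_Mapping.lookup g b when l = a)" for l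
  proof (cases "l = a")
    case True
    then show ?thesis by simp
  next
    case False
    show ?thesis
    proof (cases "l \<in> Poly_Mapping.keys f")
      case True
      have "(Poly_Mapping.lookup g q when a + b = l + q) = 0" for q
        using assms[OF True, of q] False by (cases "q \<in> Poly_Mapping.keys g") (auto simp: when_def in_keys_iff)
      then show ?thesis using False by simp
    qed (simp add: in_keys_iff)
  qed
  then show ?thesis by (simp add: lookup_mult)
qed

lemma lookup_monomial_mult:
  fixes f :: "('a, 'k::field) mpoly"
  shows "Poly_Mapping.lookup (monomial a * f) (a + b) = Poly_Mapping.lookup f b"
  by (subst lookup_mult_unique_decomposition) auto

lemma sum_monomials:
  fixes p :: "('a, 'k::field) mpoly"
  shows "(\<Sum>m\<in>Poly_Mapping.keys p. Poly_Mapping.single m (Poly_Mapping.lookup p m)) = p"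
proof (rule poly_mapping_eqI)
  fix n
  have "(\<Sum>m\<in>Poly_Mapping.keys p. (Poly_Mapping.lookup p m when m = n))
      = Poly_Mapping.lookup p n"
    by (cases "n \<in> Poly_Mapping.keys p") (auto simp: when_def in_keys_iff)
  then show "Poly_Mapping.lookup (\<Sum>m\<in>Poly_Mapping.keys p.
      Poly_Mapping.single m (Poly_Mapping.lookup p m)) n = Poly_Mapping.lookup p n"
    by (simp add: lookup_sum lookup_single)
qed

lemma ideal_poly_ring_sum:
  fixes J :: "('a, 'k::field) mpoly set"
  assumes "ideal J (poly_ring V)" and "\<And>s. s \<in> S \<Longrightarrow> h s \<in> J"
  shows "sum h S \<in> J"
  using assms(2)
proof (induction S rule: infinite_finite_induct)
  case (insert s S)
  then show ?case
    using additive_subgroup.a_closed[OF ideal.axioms(1)[OF assms(1)], of "h s" "sum h S"]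
    by simp
qed (use additive_subgroup.zero_closed[OF ideal.axioms(1)[OF assms(1)]] in auto)

section \<open>The powers of an ideal generated by variables\<close>

definition degree_in :: "'a set \<Rightarrow> ('a \<Rightarrow>\<^sub>0 nat) \<Rightarrow> nat" where
  "degree_in A m = (\<Sum>x\<in>A. Poly_Mapping.lookup m x)"

lemma degree_in_add: "degree_in A (m + n) = degree_in A m + degree_in A n"
  by (simp add: degree_in_def lookup_add sum.distrib)

lemma degree_in_single:
  "finite A \<Longrightarrow> degree_in A (Poly_Mapping.single x c) = (if x \<in> A then c else 0)"
  by (simp add: degree_in_def lookup_single when_def)

lemma degree_in_pos_iff:
  "finite A \<Longrightarrow> 0 < degree_in A m \<longleftrightarrow> (\<exists>x\<in>A. x \<in> Poly_Mapping.keys m)"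
  by (auto simp: degree_in_def in_keys_iff simp flip: neq0_conv)

text \<open>For finite \<open>A \<subseteq> V\<close> this is the \<open>n\<close>-th power of the ideal generated by the variables in
  \<open>A\<close>. Describing it by exponents instead of generators makes it easy to show that a polynomial
  does not belong to it.\<close>

definition degree_ideal :: "'a set \<Rightarrow> 'a set \<Rightarrow> nat \<Rightarrow> ('a, 'k::field) mpoly set" where
  "degree_ideal V A n =
     {p \<in> carrier (poly_ring V). \<forall>m \<in> Poly_Mapping.keys p. n \<le> degree_in A m}"

lemma degree_ideal_mult:
  fixes p q :: "('a, 'k::field) mpoly"
  assumes "p \<in> degree_ideal V A i" and "q \<in> degree_ideal V A j"
  shows "p * q \<in> degree_ideal V A (i + j)"
proof -
  have "Poly_Mapping.keys m \<subseteq> V \<and> i + j \<le> degree_in A m" if m: "m \<in> Poly_Mapping.keys (p * q)" for m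
  proof -
    obtain a b where ab: "m = a + b" "a \<in> Poly_Mapping.keys p" "b \<in> Poly_Mapping.keys q"
      using m keys_mult[of p q] by blast
    then have "Poly_Mapping.keys a \<union> Poly_Mapping.keys b \<subseteq> V"
      and "i \<le> degree_in A a" "j \<le> degree_in A b"
      using assms by (auto simp: degree_ideal_def)
    then show ?thesis
      using Poly_Mapping.keys_add[of a b] by (auto simp: ab(1) degree_in_add)
  qed
  then show ?thesis by (simp add: degree_ideal_def)
qed

lemma ideal_degree_ideal: "ideal (degree_ideal V A n :: ('a, 'k::field) mpoly set) (poly_ring V)"
proof (rule idealI[OF ring_poly_ring])
  interpret cring "poly_ring V :: ('a, 'k) mpoly ring" by (rule cring_poly_ring)
  have minus: "\<ominus>\<^bsub>poly_ring V\<^esub> p = - p" if "p \<in> carrier (poly_ring V)" for p :: "('a, 'k) mpoly"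
    by (rule minus_equality) (use that in auto)
  show "subgroup (degree_ideal V A n :: ('a, 'k) mpoly set) (add_monoid (poly_ring V))"
  proof (rule add.subgroupI)
    show "(degree_ideal V A n :: ('a, 'k) mpoly set) \<noteq> {}"
      by (auto simp: degree_ideal_def intro!: exI[of _ 0])
  next
    fix p :: "('a, 'k) mpoly" assume "p \<in> degree_ideal V A n"
    then show "\<ominus>\<^bsub>poly_ring V\<^esub> p \<in> degree_ideal V A n"
      using minus[of p] by (auto simp: degree_ideal_def)
  qed (auto simp: degree_ideal_def dest!: subsetD[OF Poly_Mapping.keys_add])
next
  fix p q :: "('a, 'k) mpoly"
  assume "p \<in> degree_ideal V A n" and "q \<in> carrier (poly_ring V)"
  then show "q \<otimes>\<^bsub>poly_ring V\<^esub> p \<in> degree_ideal V A n"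
    and "p \<otimes>\<^bsub>poly_ring V\<^esub> q \<in> degree_ideal V A n"
    using degree_ideal_mult[of p V A n q 0]
    by (simp_all add: degree_ideal_def[of V A 0] mult.commute)
qed

text \<open>Exponent vectors form a unique product monoid: in two finite sets, elements that are extremal
  for a lexicographic order have a sum that arises in no other way. The variables carry no order,
  so the extremal elements are found by induction on a finite set of variables \<open>W\<close> in which the
  exponents may differ: each step keeps those with the greatest exponent at one further
  variable.\<close>

lemma unique_product:
  fixes A B :: "('a \<Rightarrow>\<^sub>0 nat) set"
  assumes "finite W" and "finite A" "A \<noteq> {}" and "finite B" "B \<noteq> {}"
    and "\<And>m n x. \<lbrakk>m \<in> A; n \<in> A; x \<notin> W\<rbrakk> \<Longrightarrow> Poly_Mapping.lookup m x = Poly_Mapping.lookup n x"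
    and "\<And>m n x. \<lbrakk>m \<in> B; n \<in> B; x \<notin> W\<rbrakk> \<Longrightarrow> Poly_Mapping.lookup m x = Poly_Mapping.lookup n x"
  shows "\<exists>a\<in>A. \<exists>b\<in>B. \<forall>a'\<in>A. \<forall>b'\<in>B. a' + b' = a + b \<longrightarrow> a' = a"
  using assms
proof (induction W arbitrary: A B rule: finite_induct)
  case empty
  obtain a b where "a \<in> A" "b \<in> B" using empty.prems by blast
  moreover have "a' = a" if "a' \<in> A" for a'
    using empty.prems(5)[OF that \<open>a \<in> A\<close>] by (intro poly_mapping_eqI) auto
  ultimately show ?case by blast
next
  case (insert x W)
  define top where "top C = {m \<in> C. \<forall>n\<in>C. Poly_Mapping.lookup n x \<le> Poly_Mapping.lookup m x}"
    for C :: "('a \<Rightarrow>\<^sub>0 nat) set"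
  have top: "finite (top C)" "top C \<noteq> {}" if "finite C" "C \<noteq> {}" for C
  proof -
    have "Max ((\<lambda>n. Poly_Mapping.lookup n x) ` C) \<in> (\<lambda>n. Poly_Mapping.lookup n x) ` C"
      using that by (intro Max_in) auto
    then obtain m where "m \<in> C"
      "Max ((\<lambda>n. Poly_Mapping.lookup n x) ` C) = Poly_Mapping.lookup m x" by blast
    moreover have "Poly_Mapping.lookup n x \<le> Max ((\<lambda>n. Poly_Mapping.lookup n x) ` C)"
      if "n \<in> C" for n
      using that \<open>finite C\<close> by simp
    ultimately have "m \<in> top C" by (simp add: top_def)
    then show "finite (top C)" "top C \<noteq> {}" using that by (auto simp: top_def)
  qed
  have "\<exists>a\<in>top A. \<exists>b\<in>top B. \<forall>a'\<in>top A. \<forall>b'\<in>top B. a' + b' = a + b \<longrightarrow> a' = a"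
  proof (rule insert.IH)
    show "Poly_Mapping.lookup m z = Poly_Mapping.lookup n z"
      if "m \<in> top A" "n \<in> top A" "z \<notin> W" for m n z
      using that insert.prems(5)[of m n z] by (cases "z = x") (auto simp: top_def intro: antisym)
    show "Poly_Mapping.lookup m z = Poly_Mapping.lookup n z"
      if "m \<in> top B" "n \<in> top B" "z \<notin> W" for m n z
      using that insert.prems(6)[of m n z] by (cases "z = x") (auto simp: top_def intro: antisym)
  qed (use top insert.prems in auto)
  \<comment> \<open>A sum of two maximal \<open>x\<close>-exponents is attained only by two maximal ones, so competing
    decompositions stay inside \<open>top A\<close> and \<open>top B\<close>.\<close>
  then obtain a b where ab: "a \<in> top A" "b \<in> top B"
    and unique: "\<And>a' b'. \<lbrakk>a' \<in> top A; b' \<in> top B; a' + b' = a + b\<rbrakk> \<Longrightarrow> a' = a"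
    by blast
  have "a' = a" if "a' \<in> A" "b' \<in> B" and eq: "a' + b' = a + b" for a' b'
  proof -
    have "Poly_Mapping.lookup a' x + Poly_Mapping.lookup b' x
        = Poly_Mapping.lookup a x + Poly_Mapping.lookup b x"
      using eq by (metis lookup_add)
    moreover have "Poly_Mapping.lookup a' x \<le> Poly_Mapping.lookup a x"
      and "Poly_Mapping.lookup b' x \<le> Poly_Mapping.lookup b x"
      using ab that by (auto simp: top_def)
    ultimately have "Poly_Mapping.lookup a' x = Poly_Mapping.lookup a x"
      and "Poly_Mapping.lookup b' x = Poly_Mapping.lookup b x"
      by simp_all
    then have "a' \<in> top A" "b' \<in> top B" using ab that by (auto simp: top_def)
    then show ?thesis using unique eq by blast
  qed
  then show ?case using ab by (auto simp: top_def)
qed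

text \<open>The quotient by the variables in \<open>A\<close> is the polynomial ring in the others, and that is a
  domain: if \<open>p\<close> and \<open>q\<close> both have monomials free of \<open>A\<close>, then two of those have a product that
  survives in \<open>p q\<close>.\<close>

lemma primeideal_degree_ideal:
  assumes "finite A"
  shows "primeideal (degree_ideal V A 1 :: ('a, 'k::field) mpoly set) (poly_ring V)"
proof (rule primeidealI[OF ideal_degree_ideal cring_poly_ring])
  have "(1 :: ('a, 'k) mpoly) \<notin> degree_ideal V A 1"
    by (simp add: degree_ideal_def degree_in_def)
  then show "carrier (poly_ring V) \<noteq> (degree_ideal V A 1 :: ('a, 'k) mpoly set)"
    by auto
next
  fix p q :: "('a, 'k) mpoly"
  assume carr: "p \<in> carrier (poly_ring V)" "q \<in> carrier (poly_ring V)"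
    and pq: "p \<otimes>\<^bsub>poly_ring V\<^esub> q \<in> degree_ideal V A 1"
  show "p \<in> degree_ideal V A 1 \<or> q \<in> degree_ideal V A 1"
  proof (rule ccontr)
    assume neither: "\<not> (p \<in> degree_ideal V A 1 \<or> q \<in> degree_ideal V A 1)"
    define free where "free r = {m \<in> Poly_Mapping.keys r. degree_in A m = 0}"
      for r :: "('a, 'k) mpoly"
    have "free p \<noteq> {}" "free q \<noteq> {}"
      using neither carr by (auto simp: degree_ideal_def free_def not_le)
    define W where "W = \<Union> (Poly_Mapping.keys ` (Poly_Mapping.keys p \<union> Poly_Mapping.keys q))"
    have "\<exists>a\<in>free p. \<exists>b\<in>free q. \<forall>a'\<in>free p. \<forall>b'\<in>free q. a' + b' = a + b \<longrightarrow> a' = a"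
    proof (rule unique_product)
      show "finite W" by (simp add: W_def)
      show "Poly_Mapping.lookup m x = Poly_Mapping.lookup n x"
        if "m \<in> free p" "n \<in> free p" "x \<notin> W" for m n x
        using that by (auto simp: W_def free_def in_keys_iff)
      show "Poly_Mapping.lookup m x = Poly_Mapping.lookup n x"
        if "m \<in> free q" "n \<in> free q" "x \<notin> W" for m n x
        using that by (auto simp: W_def free_def in_keys_iff)
    qed (use \<open>free p \<noteq> {}\<close> \<open>free q \<noteq> {}\<close> in \<open>auto simp: free_def\<close>)
    then obtain a b where ab: "a \<in> free p" "b \<in> free q"
      and unique: "\<And>a' b'. \<lbrakk>a' \<in> free p; b' \<in> free q; a' + b' = a + b\<rbrakk> \<Longrightarrow> a' = a"
      by blast
    have deg: "degree_in A (a + b) = 0"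
      using ab by (simp add: free_def degree_in_add)
    have "Poly_Mapping.lookup (p * q) (a + b) = Poly_Mapping.lookup p a * Poly_Mapping.lookup q b"
    proof (rule lookup_mult_unique_decomposition)
      fix a' b' assume "a' \<in> Poly_Mapping.keys p" "b' \<in> Poly_Mapping.keys q" "a' + b' = a + b"
      moreover from this have "degree_in A a' = 0" "degree_in A b' = 0"
        using deg by (metis degree_in_add add_is_0)+
      ultimately show "a' = a" using unique by (auto simp: free_def)
    qed
    then have "a + b \<in> Poly_Mapping.keys (p * q)"
      using ab by (auto simp: free_def in_keys_iff)
    then show False using pq deg by (auto simp: degree_ideal_def)
  qed
qed

section \<open>Powers of ideals\<close>

lemma ideal_power_0: "ideal_power R I 0 = carrier R"
  by (simp add: ideal_power_def ideals_set_def)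

lemma (in cring) ideal_power_Suc:
  assumes "ideal I R"
  shows "ideal_power R I (Suc k) = ideal_power R I k \<cdot> I"
proof -
  interpret ideals: comm_monoid "ideals_set R" by (rule ideals_set_is_comm_monoid)
  show ?thesis by (simp add: ideal_power_def) (simp add: ideals_set_def)
qed

lemma (in cring) ideal_ideal_power:
  assumes "ideal I R"
  shows "ideal (ideal_power R I k) R"
  by (induction k)
    (simp_all add: ideal_power_0 ideal_power_Suc oneideal assms ideal_prod_is_ideal)

lemma (in cring) ideal_power_SucI:
  "\<lbrakk>ideal I R; p \<in> ideal_power R I k; q \<in> I\<rbrakk> \<Longrightarrow> p \<otimes> q \<in> ideal_power R I (Suc k)"
  by (simp add: ideal_power_Suc ideal_prod.prod)

lemma (in cring) primeideal_ideal_power: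
  assumes "ideal I R" and "primeideal P R" and "ideal_power R I k \<subseteq> P"
  shows "I \<subseteq> P"
  using assms(3)
proof (induction k)
  case 0
  then show ?case
    using primeideal.I_notcarr[OF assms(2)] ideal.Icarr[OF primeideal.axioms(1)[OF assms(2)]]
    by (auto simp: ideal_power_0)
next
  case (Suc k)
  then show ?case
    using primeideal_divides_ideal_prod[OF assms(2) ideal_ideal_power[OF assms(1)] assms(1)]
    by (auto simp: ideal_power_Suc assms(1))
qed

text \<open>Degrees in \<open>A\<close> add up under multiplication, so a lower bound of one on \<open>I\<close> becomes a lower
  bound of \<open>k\<close> on the \<open>k\<close>-th power. For a bipartite graph this is used with either partite set
  as \<open>A\<close>.\<close>

lemma ideal_power_subset_degree_ideal:
  fixes I :: "('a, 'k::field) mpoly set"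
  assumes "ideal I (poly_ring V)" and "I \<subseteq> degree_ideal V A 1"
  shows "ideal_power (poly_ring V) I k \<subseteq> degree_ideal V A k"
proof (induction k)
  case 0
  then show ?case by (simp add: ideal_power_0 degree_ideal_def)
next
  case (Suc k)
  interpret cring "poly_ring V :: ('a, 'k) mpoly ring" by (rule cring_poly_ring)
  show ?case
  proof
    fix s assume "s \<in> ideal_power (poly_ring V) I (Suc k)"
    then have "s \<in> ideal_power (poly_ring V) I k \<cdot>\<^bsub>poly_ring V\<^esub> I"
      by (simp add: ideal_power_Suc assms(1))
    then show "s \<in> degree_ideal V A (Suc k)"
    proof (induction rule: ideal_prod.induct)
      case (prod i j)
      then show ?case using degree_ideal_mult[of i V A k j 1] Suc assms(2) by auto
    next
      case (sum s1 s2)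
      then show ?case
        using additive_subgroup.a_closed[OF ideal.axioms(1)[OF ideal_degree_ideal]] by blast
    qed
  qed
qed

text \<open>The class of \<open>f\<close> in \<open>R/I\<close> has annihilator \<open>(I : f)\<close>.\<close>

lemma (in cring) colon_ideal_in_assoc_primes:
  assumes "ideal I R" and "f \<in> carrier R" and "primeideal (colon_ideal R I f) R"
  shows "colon_ideal R I f \<in> assoc_primes R I"
proof -
  interpret ideal I R by (rule assms(1))
  have "(I +> g) \<otimes>\<^bsub>R Quot I\<^esub> (I +> f) = \<zero>\<^bsub>R Quot I\<^esub> \<longleftrightarrow> g \<otimes> f \<in> I" if "g \<in> carrier R" for g
  proof -
    have "(I +> g) \<otimes>\<^bsub>R Quot I\<^esub> (I +> f) = I +> (g \<otimes> f)"
      using that assms(2) by (simp add: FactRing_def rcoset_mult_add)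
    moreover have "\<zero>\<^bsub>R Quot I\<^esub> = I" by (simp add: FactRing_def)
    moreover have "I +> (g \<otimes> f) = I \<longleftrightarrow> g \<otimes> f \<in> I"
      using that assms(2) a_rcos_self[of "g \<otimes> f"] a_rcos_const[of "g \<otimes> f"] by auto
    ultimately show ?thesis by simp
  qed
  then have "colon_ideal R I f
      = {g \<in> carrier R. (I +> g) \<otimes>\<^bsub>R Quot I\<^esub> (I +> f) = \<zero>\<^bsub>R Quot I\<^esub>}"
    by (auto simp: colon_ideal_def)
  moreover have "I +> f \<in> carrier (R Quot I)"
    using assms(2) by (auto simp: FactRing_def A_RCOSETS_def')
  ultimately show ?thesis
    using assms(3) unfolding assoc_primes_def by blast
qed

section \<open>Edge ideals of connected bipartite graphs\<close>

locale connected_bipartite_graph = graph G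
  for G :: "('a, 'b) pre_digraph" +
  fixes X Y :: "'a set"
  assumes connected: "Digraph_Component.connected G"
    and partite: "partite_sets G X Y"
begin

lemma finite_parts: "finite X" "finite Y"
  using partite finite_verts by (auto simp: partite_sets_def)

lemma swap_parts: "connected_bipartite_graph G Y X"
  using connected partite graph_axioms
  by (auto simp: connected_bipartite_graph_def connected_bipartite_graph_axioms_def
      partite_sets_def)

lemma adjacent_sym: "u \<rightarrow>\<^bsub>G\<^esub> v \<Longrightarrow> v \<rightarrow>\<^bsub>G\<^esub> u"
  using graph_symmetric by blast

lemma neighbour_of_X: "\<lbrakk>x \<in> X; x \<rightarrow>\<^bsub>G\<^esub> y\<rbrakk> \<Longrightarrow> y \<in> Y"
  and neighbour_of_Y: "\<lbrakk>y \<in> Y; y \<rightarrow>\<^bsub>G\<^esub> x\<rbrakk> \<Longrightarrow> x \<in> X"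
  using partite unfolding partite_sets_def by blast+

lemma edge_leaving:
  assumes "A \<subseteq> verts G" and "A \<noteq> {}" and "A \<noteq> verts G"
  obtains u v where "u \<in> A" "v \<in> verts G - A" "u \<rightarrow>\<^bsub>G\<^esub> v"
proof -
  obtain a b where ab: "a \<in> A" "b \<in> verts G" "b \<notin> A" using assms by blast
  have "a \<rightarrow>\<^sup>*\<^bsub>G\<^esub> b"
    using symmetric_connected_imp_strongly_connected[OF sym_arcs connected] ab assms(1) by blast
  then have "\<exists>u v. u \<in> A \<and> v \<in> verts G - A \<and> u \<rightarrow>\<^bsub>G\<^esub> v"
  proof (rule contrapos_pp)
    assume none: "\<not> ?thesis"
    show "\<not> a \<rightarrow>\<^sup>*\<^bsub>G\<^esub> b"
    proof
      assume "a \<rightarrow>\<^sup>*\<^bsub>G\<^esub> b"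
      then have "b \<in> A"
      proof (induction rule: reachable_induct)
        case (step x y)
        then show ?case using none adj_in_verts by blast
      qed (use ab in simp)
      then show False using ab by simp
    qed
  qed
  then show thesis using that by blast
qed

lemma neighbour_exists:
  assumes "x \<in> X"
  obtains y where "y \<in> Y" "x \<rightarrow>\<^bsub>G\<^esub> y"
proof -
  have "{x} \<subseteq> verts G" "{x} \<noteq> verts G" using assms partite by (auto simp: partite_sets_def)
  then obtain y where "x \<rightarrow>\<^bsub>G\<^esub> y" using edge_leaving[of "{x}"] by blast
  then show thesis using that neighbour_of_X[OF assms] by blast
qed

text \<open>An edge leaving the set of \<open>T\<close> together with all neighbours of \<open>T\<close> must start at one of the
  neighbours, hence lead back to \<open>Y\<close>.\<close>

lemma common_neighbour:
  assumes "T \<subseteq> Y" and "T \<noteq> {}" and "T \<noteq> Y"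
  obtains x t y where "x \<in> X" "t \<in> T" "y \<in> Y - T" "x \<rightarrow>\<^bsub>G\<^esub> t" "x \<rightarrow>\<^bsub>G\<^esub> y"
proof -
  let ?A = "T \<union> {x \<in> X. \<exists>t\<in>T. x \<rightarrow>\<^bsub>G\<^esub> t}"
  have "?A \<subseteq> verts G" "?A \<noteq> {}" "?A \<noteq> verts G"
    using assms partite by (auto simp: partite_sets_def)
  then obtain u v where uv: "u \<in> ?A" "v \<in> verts G - ?A" "u \<rightarrow>\<^bsub>G\<^esub> v" by (rule edge_leaving)
  have "u \<notin> T"
    using uv assms(1) neighbour_of_Y[of u v] adjacent_sym[of u v] by blast
  then obtain t where "u \<in> X" "t \<in> T" "u \<rightarrow>\<^bsub>G\<^esub> t" using uv by blast
  moreover have "v \<in> Y - T"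
    using uv neighbour_of_X[OF \<open>u \<in> X\<close> uv(3)] by blast
  ultimately show thesis using that uv(3) by blast
qed

abbreviation edge_power :: "nat \<Rightarrow> ('a, 'k::field) mpoly set" where
  "edge_power k \<equiv> ideal_power (poly_ring (verts G)) (edge_ideal G) k"

lemma edge_generators_subset:
  "{pvar u * pvar v | u v. u \<rightarrow>\<^bsub>G\<^esub> v} \<subseteq> carrier (poly_ring (verts G) :: ('a, 'k::field) mpoly ring)"
  using adj_in_verts
  by (auto simp: pvar_def mult_single dest!: subsetD[OF Poly_Mapping.keys_add] split: if_splits)

lemma ideal_edge_ideal: "ideal (edge_ideal G :: ('a, 'k::field) mpoly set) (poly_ring (verts G))"
  unfolding edge_ideal_def by (rule ring.genideal_ideal[OF ring_poly_ring edge_generators_subset])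

lemma edge_in_edge_ideal:
  "u \<rightarrow>\<^bsub>G\<^esub> v \<Longrightarrow> (pvar u * pvar v :: ('a, 'k::field) mpoly) \<in> edge_ideal G"
  unfolding edge_ideal_def
  by (rule subsetD[OF ring.genideal_self[OF ring_poly_ring edge_generators_subset]]) auto

lemma ideal_edge_power: "ideal (edge_power k :: ('a, 'k::field) mpoly set) (poly_ring (verts G))"
  by (rule cring.ideal_ideal_power[OF cring_poly_ring ideal_edge_ideal])

lemma edge_power_SucI:
  "\<lbrakk>(p :: ('a, 'k::field) mpoly) \<in> edge_power k; u \<rightarrow>\<^bsub>G\<^esub> v\<rbrakk>
     \<Longrightarrow> p * (pvar u * pvar v) \<in> edge_power (Suc k)"
  using cring.ideal_power_SucI[OF cring_poly_ring ideal_edge_ideal _ edge_in_edge_ideal] by force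

lemma edge_power_subset_Y:
  "(edge_power k :: ('a, 'k::field) mpoly set) \<subseteq> degree_ideal (verts G) Y k"
proof (rule ideal_power_subset_degree_ideal[OF ideal_edge_ideal])
  have "pvar u * pvar v \<in> (degree_ideal (verts G) Y 1 :: ('a, 'k) mpoly set)" if "u \<rightarrow>\<^bsub>G\<^esub> v" for u v
  proof -
    have "(pvar u * pvar v :: ('a, 'k) mpoly) \<in> carrier (poly_ring (verts G))"
      using edge_generators_subset that by blast
    moreover have "u \<in> Y \<or> v \<in> Y" using that partite by (auto simp: partite_sets_def)
    ultimately show ?thesis
      by (auto simp: degree_ideal_def pvar_def mult_single degree_in_add degree_in_single finite_parts)
  qed
  then show "(edge_ideal G :: ('a, 'k) mpoly set) \<subseteq> degree_ideal (verts G) Y 1"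
    unfolding edge_ideal_def
    by (intro ring.genideal_minimal[OF ring_poly_ring ideal_degree_ideal]) auto
qed

lemma edge_power_subset_X:
  "(edge_power k :: ('a, 'k::field) mpoly set) \<subseteq> degree_ideal (verts G) X k"
  by (rule connected_bipartite_graph.edge_power_subset_Y[OF swap_parts])

lemma degree_in_parts:
  assumes "Poly_Mapping.keys m \<subseteq> verts G"
  shows "(\<Sum>x\<in>Poly_Mapping.keys m. Poly_Mapping.lookup m x) = degree_in X m + degree_in Y m"
proof -
  have "(\<Sum>x\<in>Poly_Mapping.keys m. Poly_Mapping.lookup m x)
      = (\<Sum>x\<in>verts G. Poly_Mapping.lookup m x)"
    by (rule sum.mono_neutral_left) (use assms in \<open>auto simp: in_keys_iff\<close>)
  also have "\<dots> = degree_in X m + degree_in Y m"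
    using partite finite_parts by (simp add: partite_sets_def degree_in_def sum.union_disjoint)
  finally show ?thesis .
qed

subsection \<open>The lower bound\<close>

text \<open>Some variable \<open>z\<close> of an edge lies in \<open>P\<close>. Every monomial of \<open>z f \<in> I\<^sup>k\<close> has degree at least
  \<open>k\<close> in \<open>X\<close> and at least \<open>k\<close> in \<open>Y\<close>, whereas its total degree is \<open>d + 1\<close>.\<close>

lemma v_number_lower_bound:
  fixes f :: "('a, 'k::field) mpoly"
  assumes f: "f \<in> graded_piece (verts G) d"
    and P: "primeideal P (poly_ring (verts G))"
    and colon: "colon_ideal (poly_ring (verts G)) (edge_power k) f = P"
  shows "2 * k \<le> d + 1"
proof -
  let ?R = "poly_ring (verts G) :: ('a, 'k) mpoly ring"
  interpret R: cring ?R by (rule cring_poly_ring)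
  interpret P: primeideal P ?R by (rule P)
  interpret I: ideal "edge_power k :: ('a, 'k) mpoly set" ?R by (rule ideal_edge_power)
  have fcarr: "f \<in> carrier ?R" using f by (simp add: graded_piece_def)
  have "edge_power k \<subseteq> P"
    using I.I_r_closed[OF _ fcarr] I.Icarr by (auto simp: colon_ideal_def simp flip: colon)
  then have sub: "edge_ideal G \<subseteq> P"
    by (rule R.primeideal_ideal_power[OF ideal_edge_ideal P])
  obtain x where "x \<in> X" using partite by (auto simp: partite_sets_def)
  then obtain y where xy: "x \<rightarrow>\<^bsub>G\<^esub> y" using neighbour_exists by blast
  have carr: "pvar x \<in> carrier ?R" "pvar y \<in> carrier ?R"
    using adj_in_verts[OF xy] by (auto simp: pvar_def)
  have "pvar x * pvar y \<in> P" using sub edge_in_edge_ideal[OF xy] by blast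
  then have "pvar x \<in> P \<or> pvar y \<in> P"
    using P.I_prime[OF carr] by simp
  then obtain z where z: "z \<in> verts G" "pvar z \<in> P"
    using adj_in_verts[OF xy] by blast
  then have zf: "pvar z * f \<in> edge_power k" by (auto simp: colon_ideal_def simp flip: colon)
  have "f \<noteq> 0"
  proof
    assume "f = 0"
    then have "colon_ideal ?R (edge_power k) f = carrier ?R"
      using I.zero_closed by (simp add: colon_ideal_def)
    then show False using P.I_notcarr colon by simp
  qed
  then obtain m where m: "m \<in> Poly_Mapping.keys f" by (auto simp flip: keys_eq_empty)
  let ?n = "Poly_Mapping.single z 1 + m"
  have n: "?n \<in> Poly_Mapping.keys (pvar z * f)"
    using m by (simp add: in_keys_iff pvar_def lookup_monomial_mult)
  have mV: "Poly_Mapping.keys m \<subseteq> verts G" using m fcarr by auto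
  have "k \<le> degree_in X ?n" "k \<le> degree_in Y ?n"
    using zf n edge_power_subset_X edge_power_subset_Y by (force simp: degree_ideal_def)+
  moreover have "degree_in X ?n + degree_in Y ?n = 1 + (degree_in X m + degree_in Y m)"
    using z(1) partite finite_parts by (auto simp: degree_in_add degree_in_single partite_sets_def)
  moreover have "degree_in X m + degree_in Y m = d"
    using f m degree_in_parts[OF mV] by (simp add: graded_piece_def)
  ultimately show ?thesis by simp
qed

subsection \<open>The upper bound\<close>

text \<open>The set \<open>T\<close> consists of variables in the colon ideal of the power \<open>n + 1\<close> by the monomial. It
  starts as the neighbourhood of \<open>x\<^sub>0\<close>, and each further edge multiplied to the monomial lets it
  gain an element, until it is all of \<open>Y\<close>.\<close>

lemma monomial_for_many_neighbours:
  assumes "x\<^sub>0 \<in> X"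
  shows "\<exists>m T. Poly_Mapping.keys m \<subseteq> verts G \<and> degree_in X m = Suc n \<and> degree_in Y m = n \<and>
    T \<subseteq> Y \<and> T \<noteq> {} \<and> min (card Y) (vdeg G x\<^sub>0 + n) \<le> card T \<and>
    (\<forall>y\<in>T. (pvar y * monomial m :: ('a, 'k::field) mpoly) \<in> edge_power (Suc n))"
proof (induction n)
  case 0
  let ?T = "{y \<in> verts G. x\<^sub>0 \<rightarrow>\<^bsub>G\<^esub> y}"
  have "?T \<subseteq> Y" using neighbour_of_X[OF assms] by blast
  moreover obtain y where "x\<^sub>0 \<rightarrow>\<^bsub>G\<^esub> y" using neighbour_exists[OF assms] .
  then have "?T \<noteq> {}" using adj_in_verts by blast
  moreover have "(pvar y * monomial (Poly_Mapping.single x\<^sub>0 1) :: ('a, 'k) mpoly) \<in> edge_power (Suc 0)"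
    if "y \<in> ?T" for y
    using edge_power_SucI[of "1 :: ('a, 'k) mpoly" 0 y x\<^sub>0] that adjacent_sym[of x\<^sub>0 y]
    by (simp add: ideal_power_0 pvar_def)
  moreover have "x\<^sub>0 \<in> verts G" "x\<^sub>0 \<notin> Y" using assms partite by (auto simp: partite_sets_def)
  ultimately show ?case
    using assms finite_parts
    by (intro exI[of _ "Poly_Mapping.single x\<^sub>0 1"] exI[of _ ?T])
      (auto simp: degree_in_single vdeg_def)
next
  case (Suc n)
  then obtain m T where m: "Poly_Mapping.keys m \<subseteq> verts G" "degree_in X m = Suc n" "degree_in Y m = n"
    and T: "T \<subseteq> Y" "T \<noteq> {}" "min (card Y) (vdeg G x\<^sub>0 + n) \<le> card T"
    and in_power: "\<And>y. y \<in> T \<Longrightarrow> (pvar y * monomial m :: ('a, 'k) mpoly) \<in> edge_power (Suc n)"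
    by blast
  have "\<exists>x t T'. x \<in> X \<and> t \<in> T \<and> x \<rightarrow>\<^bsub>G\<^esub> t \<and> T \<subseteq> T' \<and> T' \<subseteq> Y \<and>
      min (card Y) (vdeg G x\<^sub>0 + Suc n) \<le> card T' \<and> (\<forall>y \<in> T' - T. x \<rightarrow>\<^bsub>G\<^esub> y)"
  proof (cases "T = Y")
    case True
    obtain t where "t \<in> Y" "x\<^sub>0 \<rightarrow>\<^bsub>G\<^esub> t" using neighbour_exists[OF assms] .
    then show ?thesis using True assms by (intro exI[of _ x\<^sub>0] exI[of _ t] exI[of _ Y]) auto
  next
    case False
    obtain x t y where *: "x \<in> X" "t \<in> T" "y \<in> Y - T" "x \<rightarrow>\<^bsub>G\<^esub> t" "x \<rightarrow>\<^bsub>G\<^esub> y"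
      using common_neighbour[OF T(1,2) False] .
    have "card (insert y T) = Suc (card T)"
      using * finite_subset[OF T(1)] finite_parts by simp
    then show ?thesis
      using * T by (intro exI[of _ x] exI[of _ t] exI[of _ "insert y T"]) auto
  qed
  then obtain x t T' where x: "x \<in> X" and t: "t \<in> T" and xt: "x \<rightarrow>\<^bsub>G\<^esub> t"
    and T': "T \<subseteq> T'" "T' \<subseteq> Y" "min (card Y) (vdeg G x\<^sub>0 + Suc n) \<le> card T'"
    and new: "\<And>y. y \<in> T' - T \<Longrightarrow> x \<rightarrow>\<^bsub>G\<^esub> y"
    by blast
  let ?m = "m + (Poly_Mapping.single x 1 + Poly_Mapping.single t 1)"
  \<comment> \<open>Multiplying by the edge \<open>x t\<close> handles the old elements of \<open>T'\<close>; for a new \<open>y\<close> the factor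
    \<open>t\<close> pairs with the old monomial and \<open>x\<close> pairs with \<open>y\<close>.\<close>
  have mono: "(monomial ?m :: ('a, 'k) mpoly) = monomial m * (pvar x * pvar t)"
    by (simp add: pvar_def mult_single)
  have "(pvar y * monomial ?m :: ('a, 'k) mpoly) \<in> edge_power (Suc (Suc n))" if "y \<in> T'" for y
  proof (cases "y \<in> T")
    case True
    then show ?thesis using edge_power_SucI[OF in_power xt] by (simp only: mono mult.assoc)
  next
    case False
    have "pvar y * monomial ?m = (pvar t * monomial m) * (pvar x * pvar y :: ('a, 'k) mpoly)"
      by (simp only: mono mult_ac)
    then show ?thesis using edge_power_SucI[OF in_power[OF t] new, of y] that False by simp
  qed
  moreover have "x \<in> verts G" "t \<in> verts G" using adj_in_verts[OF xt] by auto
  then have "Poly_Mapping.keys ?m \<subseteq> verts G"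
    using m(1) by (auto dest!: subsetD[OF Poly_Mapping.keys_add] split: if_splits)
  moreover have "x \<notin> Y" "t \<in> Y" "t \<notin> X" using x t T(1) partite by (auto simp: partite_sets_def)
  then have "degree_in X ?m = Suc (Suc n)" "degree_in Y ?m = Suc n"
    using m x finite_parts by (simp_all add: degree_in_add degree_in_single)
  ultimately show ?case using T' T(2)
    by (intro exI[of _ ?m] exI[of _ T']) auto
qed

text \<open>Membership in the power \<open>n + 1\<close> requires degree \<open>n + 1\<close> in \<open>Y\<close>. Since \<open>m\<close> has only degree
  \<open>n\<close> there, each monomial of a multiplier must supply a variable of \<open>Y\<close>; any single such variable
  suffices by assumption.\<close>

lemma colon_monomial:
  assumes m: "Poly_Mapping.keys m \<subseteq> verts G" "degree_in Y m = n"
    and in_power: "\<And>y. y \<in> Y \<Longrightarrow> (pvar y * monomial m :: ('a, 'k::field) mpoly) \<in> edge_power (Suc n)"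
  shows "colon_ideal (poly_ring (verts G)) (edge_power (Suc n)) (monomial m)
    = (degree_ideal (verts G) Y 1 :: ('a, 'k) mpoly set)"
proof (intro equalityI subsetI)
  fix g :: "('a, 'k) mpoly"
  assume "g \<in> colon_ideal (poly_ring (verts G)) (edge_power (Suc n)) (monomial m)"
  then have g: "g \<in> carrier (poly_ring (verts G))" "monomial m * g \<in> edge_power (Suc n)"
    by (simp_all add: colon_ideal_def mult.commute)
  have "1 \<le> degree_in Y a" if "a \<in> Poly_Mapping.keys g" for a
  proof -
    have "m + a \<in> Poly_Mapping.keys (monomial m * g)"
      using that by (simp add: in_keys_iff lookup_monomial_mult)
    then have "Suc n \<le> degree_in Y (m + a)"
      using g(2) edge_power_subset_Y by (force simp: degree_ideal_def)
    then show ?thesis using m(2) by (simp add: degree_in_add)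
  qed
  then show "g \<in> degree_ideal (verts G) Y 1" using g(1) by (simp add: degree_ideal_def)
next
  fix g :: "('a, 'k) mpoly"
  assume g: "g \<in> degree_ideal (verts G) Y 1"
  let ?term = "\<lambda>a. Poly_Mapping.single a (Poly_Mapping.lookup g a) :: ('a, 'k) mpoly"
  have "?term a * monomial m \<in> edge_power (Suc n)" if a: "a \<in> Poly_Mapping.keys g" for a
  proof -
    have aV: "Poly_Mapping.keys a \<subseteq> verts G" and "0 < degree_in Y a"
      using g a by (fastforce simp: degree_ideal_def)+
    then obtain y where y: "y \<in> Y" "y \<in> Poly_Mapping.keys a"
      using degree_in_pos_iff finite_parts by blast
    define b where "b = a - Poly_Mapping.single y 1"
    have ab: "a = b + Poly_Mapping.single y 1"
      using y(2) by (intro poly_mapping_eqI)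
        (auto simp: b_def lookup_add lookup_minus lookup_single when_def in_keys_iff)
    have "Poly_Mapping.keys b \<subseteq> verts G"
      using aV by (auto simp: b_def in_keys_iff lookup_minus)
    then have "Poly_Mapping.single b (Poly_Mapping.lookup g a) \<in>
        carrier (poly_ring (verts G) :: ('a, 'k) mpoly ring)"
      by simp
    from ideal.I_l_closed[OF ideal_edge_power in_power[OF y(1)] this]
    show ?thesis by (simp add: pvar_def mult_single ab ac_simps)
  qed
  then have "(\<Sum>a\<in>Poly_Mapping.keys g. ?term a * monomial m) \<in> edge_power (Suc n)"
    by (rule ideal_poly_ring_sum[OF ideal_edge_power])
  then have "g * monomial m \<in> edge_power (Suc n)"
    by (simp add: sum_monomials flip: sum_distrib_right)
  then show "g \<in> colon_ideal (poly_ring (verts G)) (edge_power (Suc n)) (monomial m)"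
    using g by (simp add: colon_ideal_def degree_ideal_def)
qed

lemma v_number_edge_power:
  assumes k: "card Y + 1 - Max (vdeg G ` X) \<le> k"
  shows "v_number (verts G) (edge_power k :: ('a, 'k::field) mpoly set) = 2 * k - 1"
proof -
  have "Max (vdeg G ` X) \<in> vdeg G ` X"
    using partite finite_parts by (intro Max_in) (auto simp: partite_sets_def)
  then obtain x\<^sub>0 where x0: "x\<^sub>0 \<in> X" "vdeg G x\<^sub>0 = Max (vdeg G ` X)" by auto
  have "{y \<in> verts G. x\<^sub>0 \<rightarrow>\<^bsub>G\<^esub> y} \<subseteq> Y" using neighbour_of_X[OF x0(1)] by blast
  then have "vdeg G x\<^sub>0 \<le> card Y" unfolding vdeg_def by (rule card_mono[OF finite_parts(2)])
  then obtain n where n: "k = Suc n" using k x0(2) by (cases k) auto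
  obtain m T where m: "Poly_Mapping.keys m \<subseteq> verts G" "degree_in X m = Suc n" "degree_in Y m = n"
    and T: "T \<subseteq> Y" "min (card Y) (vdeg G x\<^sub>0 + n) \<le> card T"
      "\<And>y. y \<in> T \<Longrightarrow> (pvar y * monomial m :: ('a, 'k) mpoly) \<in> edge_power (Suc n)"
    using monomial_for_many_neighbours[OF x0(1)] by metis
  \<comment> \<open>With \<open>n = k - 1\<close> the hypothesis on \<open>k\<close> says \<open>|Y| \<le> deg x\<^sub>0 + n\<close>, so \<open>T\<close> has exhausted
    \<open>Y\<close>.\<close>
  have "card Y \<le> card T" using T(2) k n x0(2) by simp
  then have "T = Y" using T(1) finite_parts(2) by (simp add: card_seteq)
  then have colon: "colon_ideal (poly_ring (verts G)) (edge_power k) (monomial m)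
      = (degree_ideal (verts G) Y 1 :: ('a, 'k) mpoly set)"
    unfolding n using T(3) by (intro colon_monomial[OF m(1,3)]) simp
  have "colon_ideal (poly_ring (verts G)) (edge_power k) (monomial m :: ('a, 'k) mpoly)
      \<in> assoc_primes (poly_ring (verts G)) (edge_power k)"
  proof (rule cring.colon_ideal_in_assoc_primes[OF cring_poly_ring ideal_edge_power])
    show "primeideal (colon_ideal (poly_ring (verts G)) (edge_power k)
        (monomial m :: ('a, 'k) mpoly)) (poly_ring (verts G))"
      unfolding colon by (rule primeideal_degree_ideal[OF finite_parts(2)])
  qed (use m(1) in simp)
  moreover have "(monomial m :: ('a, 'k) mpoly) \<in> graded_piece (verts G) (2 * k - 1)"
    using m degree_in_parts[OF m(1)] n by (simp add: graded_piece_def)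
  moreover have "2 * k - 1 \<le> d"
    if "f \<in> graded_piece (verts G) d"
      "P \<in> assoc_primes (poly_ring (verts G)) (edge_power k)"
      "colon_ideal (poly_ring (verts G)) (edge_power k) f = P"
    for d and f :: "('a, 'k) mpoly" and P
    using v_number_lower_bound[OF that(1) _ that(3)] that(2) by (simp add: assoc_primes_def)
  ultimately show ?thesis
    unfolding v_number_def by (intro cInf_eq_minimum) blast+
qed

end

theorem theorem5p5:
  fixes G :: "('a, 'b) pre_digraph"
    and X Y :: "'a set"
    and I :: "('a, 'k::field) mpoly set"
    and k :: nat
  assumes "graph G"
    and "Digraph_Component.connected G"
    and "partite_sets G X Y"
    and "I = edge_ideal G"
    and "k \<ge> min (card Y + 1 - Max (vdeg G ` X)) (card X + 1 - Max (vdeg G ` Y))"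
  shows "v_number (verts G) (ideal_power (poly_ring (verts G)) I k) = 2 * k - 1"
proof -
  interpret connected_bipartite_graph G X Y
    using assms(1-3)
    by (simp add: connected_bipartite_graph_def connected_bipartite_graph_axioms_def)
  interpret swapped: connected_bipartite_graph G Y X by (rule swap_parts)
  show ?thesis
    using assms(4,5) v_number_edge_power swapped.v_number_edge_power
    by (auto simp: min_le_iff_disj)
qed

end
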